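(* Let $\mathcal G$ be a finite connected groupoid, $x\in\mathcal G_0$, $\tau(x)=\{\tau_y\}_{y\in\mathcal G_0}$ a transversal for $x$, $A$ a ring, and $\beta=(B_g,\beta_g)_{g\in\mathcal G}$ the lifted partial action of $\mathcal G$ on $A$ coming from a datum $(I,\gamma_{\tau(x)},\gamma_{(x)})\in\mathcal D_{\tau(x)}(A)$. Assume that $\beta$ is $\tau(x)$-global and $\gamma$-unital, and that $A=\bigoplus_{y\in\mathcal G_0}I_y=\bigoplus_{y\in\mathcal G_0}B_y$. Then $t_\beta(A)=A^\beta$ if and only if $t_{\beta_{(x)}}(B_x)=B_x^{\beta_{(x)}}$.
   Context: Conventions. Rings are associative, not necessarily unital; ideals are two-sided. A groupoid $\mathcal G$ is a small category in which every morphism is invertible; it is identified with its set of morphisms, and its set of objects $\mathcal G_0$ is identified with the set of identity morphisms. For $g\in\mathcal G$, $s(g)=g^{-1}g$ and $t(g)=gg^{-1}$; $gh$ is defined iff $s(g)=t(h)$. Put $\mathcal G(y,z)=\{g: s(g)=y,\ t(g)=z\}$ and $\mathcal G(x)=\mathcal G(x,x)$ (a group). $\mathcal G$ is connected if $\mathcal G(y,z)\neq\emptyset$ for all $y,z\in\mathcal G_0$. A transversal for $x$ is a family $\tau(x)=\{\tau_y: y\in\mathcal G_0\}$ with $\tau_y\in\mathcal G(x,y)$ and $\tau_x=x$. Put $g_x=\tau_{t(g)}^{-1}g\tau_{s(g)}\in\mathcal G(x)$. For partial bijections, $u\circ v$ has domain $v^{-1}(\mathrm{dom}(u)\cap\mathrm{ran}(v))$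 and range $u(\mathrm{dom}(u)\cap\mathrm{ran}(v))$. A partial action of a groupoid $\mathcal G$ on a ring $A$ is a family $\alpha=(A_g,\alpha_g)_{g\in\mathcal G}$ where, for each $g$, $A_{t(g)}$ is an ideal of $A$, $A_g$ is an ideal of $A_{t(g)}$, $\alpha_g:A_{g^{-1}}\to A_g$ is a ring isomorphism, $\alpha_y=\mathrm{id}_{A_y}$ for $y\in\mathcal G_0$, and $\alpha_{gh}$ extends $\alpha_g\circ\alpha_h$ whenever $s(g)=t(h)$. A partial action of a group $H$ on a ring $R$ is the one-object case with the ideal attached to the identity equal to $R$; it is unital if each of its ideals is a unital ring whose identity is a central idempotent of $R$. The partial action $\alpha$ is $\tau(x)$-global if $A_{\tau_y^{-1}}=A_x$ and $A_{\tau_y}=A_y$ for all $y\in\mathcal G_0$. An object of $\mathcal D_{\tau(x)}(A)$ is a datum $(I,\gamma_{\tau(x)},\gamma_{(x)})$ consisting of: (a) a family $I=\{I_y\}_{y\in\mathcal G_0}$ of ideals of $A$; (b) ring isomorphisms $\gamma_{\tau(x)}=\{\gamma_{\tau_y}:I_{\tau_y^{-1}}\to I_{\tau_y}\}_{y\in\mathcal G_0}$; (c) a partial action $\gamma_{(x)}=(I_h,\gamma_h)_{h\in\mathcal G(x)}$ of the group $\mathcal G(x)$ on $I_x$; such that (d) $\gamma_x=\gamma_{\tau_x}$ is the identity map of $I_x=I_{\tau_x}$; (e) $I_{\tau_y}$ is an ideal of $I_y$ and $I_{\tau_y^{-1}}$ is an ideal of $I_x$ for all $y$; (f) $\gamma_{\tau_{t(g)}}\big(I_{\tau_{t(g)}^{-1}}\cap\gamma_{g_x}(I_{\tau_{s(g)}^{-1}}\cap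 I_{g_x^{-1}})\big)$ is an ideal of $I_{t(g)}$ for all $g\in\mathcal G$. The lifted partial action coming from it is $\beta=(B_g,\beta_g)_{g\in\mathcal G}$ with $\beta_y=\mathrm{id}_{I_y}$ for $y\in\mathcal G_0$, $\beta_g=\gamma_{\tau_{t(g)}}\circ\gamma_{g_x}\circ\gamma_{\tau_{s(g)}}^{-1}$ for $g\notin\mathcal G_0$ (composition of partial bijections), and $B_g$ the range of $\beta_g$; it is a partial action of $\mathcal G$ on $A$. It is called $\gamma$-unital if $I_x$ is a unital ring and $\gamma_{(x)}$ is a unital partial group action. When $\beta$ is $\tau(x)$-global and $\gamma$-unital, $B_g=\gamma_{\tau_{t(g)}}(I_{g_x})=A1_g$ for all $g\in\mathcal G$, where $1_h$ is the identity of $I_h$ for $h\in\mathcal G(x)$ and $1_g=\gamma_{\tau_{t(g)}}(1_{g_x})$ is the identity of $B_g$, a central idempotent of $A$. The restriction $\beta_{(x)}=(B_h,\beta_h)_{h\in\mathcal G(x)}$ is a partial action of $\mathcal G(x)$ on $B_x$; it equals $\gamma_{(x)}$. $A^\beta=\{a\in A:\beta_g(a1_{g^{-1}})=a1_g\ \forall g\in\mathcal G\}$ and $B_x^{\beta_{(x)}}=\{b\in B_x:\beta_h(b1_{h^{-1}})=b1_h\ \forall h\in\mathcal G(x)\}$ are the subrings of invariants. The trace maps are $t_\beta:A\to A$, $t_\beta(a)=\sum_{g\in\mathcal G}\beta_g(a1_{g^{-1}})$, and $t_{\beta_{(x)}}:B_x\to B_x$, $t_{\beta_{(x)}}(b)=\sum_{h\in\mathcal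 G(x)}\beta_h(b1_{h^{-1}})$. *)

theory Defs
  imports Main "HOL-Library.FuncSet"
begin

section \<open>Groupoids\<close>

text \<open>
  A groupoid is identified with its set of morphisms, and an object with its identity morphism,
  so \<open>src\<close> and \<open>tgt\<close> take values in morphisms. The product \<open>gmul G g h\<close> is meaningful only if
  \<open>src G g = tgt G h\<close>.
\<close>

record 'g gpd =
  Mor  :: "'g set"
  src  :: "'g \<Rightarrow> 'g"
  tgt  :: "'g \<Rightarrow> 'g"
  gmul :: "'g \<Rightarrow> 'g \<Rightarrow> 'g"
  ginv :: "'g \<Rightarrow> 'g"

locale groupoid =
  fixes G :: "'g gpd"
  assumes src_closed: "g \<in> Mor G \<Longrightarrow> src G g \<in> Mor G"
    and tgt_closed: "g \<in> Mor G \<Longrightarrow> tgt G g \<in> Mor G"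
    and src_src: "g \<in> Mor G \<Longrightarrow> src G (src G g) = src G g"
    and tgt_src: "g \<in> Mor G \<Longrightarrow> tgt G (src G g) = src G g"
    and src_tgt: "g \<in> Mor G \<Longrightarrow> src G (tgt G g) = tgt G g"
    and tgt_tgt: "g \<in> Mor G \<Longrightarrow> tgt G (tgt G g) = tgt G g"
    and mul_closed: "\<lbrakk>g \<in> Mor G; h \<in> Mor G; src G g = tgt G h\<rbrakk> \<Longrightarrow> gmul G g h \<in> Mor G"
    and src_mul: "\<lbrakk>g \<in> Mor G; h \<in> Mor G; src G g = tgt G h\<rbrakk> \<Longrightarrow> src G (gmul G g h) = src G h"
    and tgt_mul: "\<lbrakk>g \<in> Mor G; h \<in> Mor G; src G g = tgt G h\<rbrakk> \<Longrightarrow> tgt G (gmul G g h) = tgt G g"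
    and mul_assoc: "\<lbrakk>g \<in> Mor G; h \<in> Mor G; k \<in> Mor G; src G g = tgt G h; src G h = tgt G k\<rbrakk>
        \<Longrightarrow> gmul G (gmul G g h) k = gmul G g (gmul G h k)"
    and mul_src: "g \<in> Mor G \<Longrightarrow> gmul G g (src G g) = g"
    and tgt_mul_self: "g \<in> Mor G \<Longrightarrow> gmul G (tgt G g) g = g"
    and inv_closed: "g \<in> Mor G \<Longrightarrow> ginv G g \<in> Mor G"
    and src_inv: "g \<in> Mor G \<Longrightarrow> src G (ginv G g) = tgt G g"
    and tgt_inv: "g \<in> Mor G \<Longrightarrow> tgt G (ginv G g) = src G g"
    and inv_mul: "g \<in> Mor G \<Longrightarrow> gmul G (ginv G g) g = src G g"
    and mul_inv: "g \<in> Mor G \<Longrightarrow> gmul G g (ginv G g) = tgt G g"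

definition Obj :: "'g gpd \<Rightarrow> 'g set" where
  "Obj G = src G ` Mor G"

definition Hom :: "'g gpd \<Rightarrow> 'g \<Rightarrow> 'g \<Rightarrow> 'g set" where
  "Hom G y z = {g \<in> Mor G. src G g = y \<and> tgt G g = z}"

definition isotropy :: "'g gpd \<Rightarrow> 'g \<Rightarrow> 'g gpd" where
  "isotropy G x = G\<lparr>Mor := Hom G x x\<rparr>"

definition connected_gpd :: "'g gpd \<Rightarrow> bool" where
  "connected_gpd G \<longleftrightarrow> (\<forall>y \<in> Obj G. \<forall>z \<in> Obj G. Hom G y z \<noteq> {})"

definition transversal :: "'g gpd \<Rightarrow> 'g \<Rightarrow> ('g \<Rightarrow> 'g) \<Rightarrow> bool" where
  "transversal G x \<tau> \<longleftrightarrow> (\<forall>y \<in> Obj G. \<tau> y \<in> Hom G x y) \<and> \<tau> x = x"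

text \<open>The element \<open>g\<^sub>x = \<tau>\<^bsub>t(g)\<^esub>\<^sup>-\<^sup>1 g \<tau>\<^bsub>s(g)\<^esub>\<close> of the isotropy group at \<open>x\<close>.\<close>

definition to_isotropy :: "'g gpd \<Rightarrow> ('g \<Rightarrow> 'g) \<Rightarrow> 'g \<Rightarrow> 'g" where
  "to_isotropy G \<tau> g = gmul G (ginv G (\<tau> (tgt G g))) (gmul G g (\<tau> (src G g)))"

lemma (in groupoid) groupoid_isotropy:
  assumes "x \<in> Obj G"
  shows "groupoid (isotropy G x)" and "Obj (isotropy G x) = {x}"
proof -
  have x: "x \<in> Mor G" "src G x = x" "tgt G x = x"
    using assms by (auto simp: Obj_def src_closed src_src tgt_src)
  show "groupoid (isotropy G x)"
    by unfold_locales
      (auto simp: isotropy_def Hom_def x mul_closed src_mul tgt_mul mul_assoc inv_closed src_inv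
        tgt_inv dest: mul_src tgt_mul_self inv_mul mul_inv)
  show "Obj (isotropy G x) = {x}"
    using x by (auto simp: Obj_def isotropy_def Hom_def image_iff)
qed


section \<open>Rings without identity, ideals, direct sums\<close>

definition subrng :: "'a::ring set \<Rightarrow> bool" where
  "subrng R \<longleftrightarrow> 0 \<in> R \<and> (\<forall>a \<in> R. \<forall>b \<in> R. a + b \<in> R \<and> - a \<in> R \<and> a * b \<in> R)"

definition ideal_in :: "'a::ring set \<Rightarrow> 'a set \<Rightarrow> bool" where
  "ideal_in J R \<longleftrightarrow> subrng R \<and> J \<subseteq> R \<and> 0 \<in> J \<and> (\<forall>a \<in> J. \<forall>b \<in> J. a + b \<in> J \<and> - a \<in> J) \<and>
     (\<forall>r \<in> R. \<forall>a \<in> J. r * a \<in> J \<and> a * r \<in> J)"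

definition is_identity :: "'a::ring \<Rightarrow> 'a set \<Rightarrow> bool" where
  "is_identity e R \<longleftrightarrow> e \<in> R \<and> (\<forall>r \<in> R. e * r = r \<and> r * e = r)"

definition unital :: "'a::ring set \<Rightarrow> bool" where
  "unital R \<longleftrightarrow> subrng R \<and> (\<exists>e. is_identity e R)"

definition identity_of :: "'a::ring set \<Rightarrow> 'a" where
  "identity_of R = (THE e. is_identity e R)"

definition central_idempotent :: "'a::ring \<Rightarrow> 'a set \<Rightarrow> bool" where
  "central_idempotent e R \<longleftrightarrow> e \<in> R \<and> e * e = e \<and> (\<forall>r \<in> R. e * r = r * e)"

definition internal_direct_sum :: "'a::ring set \<Rightarrow> 'i set \<Rightarrow> ('i \<Rightarrow> 'a set) \<Rightarrow> bool" where
  "internal_direct_sum R Y J \<longleftrightarrow> finite Y \<and> subrng R \<and> (\<forall>y \<in> Y. ideal_in (J y) R) \<and>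
     (\<forall>a \<in> R. \<exists>!f. f \<in> (\<Pi>\<^sub>E y \<in> Y. J y) \<and> a = (\<Sum>y \<in> Y. f y))"


section \<open>Partial bijections\<close>

text \<open>
  Partial bijections are injective partial maps \<open>'a \<rightharpoonup> 'a\<close>; their composition is the library's
  \<open>\<circ>\<^sub>m\<close>, whose domain is \<open>v\<^sup>-\<^sup>1(dom u \<inter> ran v)\<close>, and extension is \<open>\<subseteq>\<^sub>m\<close>. The image of
  a set \<open>S\<close> under \<open>f\<close> is \<open>ran (f |` S)\<close>.
\<close>

definition id_map :: "'a set \<Rightarrow> 'a \<rightharpoonup> 'a" where
  "id_map R = Some |` R"

definition inv_map :: "('a \<rightharpoonup> 'b) \<Rightarrow> 'b \<rightharpoonup> 'a" where
  "inv_map f b = (if b \<in> ran f then Some (THE a. f a = Some b) else None)"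

definition rng_iso :: "'a::ring set \<Rightarrow> 'a set \<Rightarrow> ('a \<rightharpoonup> 'a) \<Rightarrow> bool" where
  "rng_iso R S f \<longleftrightarrow> subrng R \<and> subrng S \<and> dom f = R \<and> ran f = S \<and> inj_on f R \<and>
     (\<forall>a \<in> R. \<forall>b \<in> R. the (f (a + b)) = the (f a) + the (f b) \<and>
                        the (f (a * b)) = the (f a) * the (f b))"


section \<open>Partial actions\<close>

definition partial_action ::
  "'g gpd \<Rightarrow> 'a::ring set \<Rightarrow> ('g \<Rightarrow> 'a set) \<Rightarrow> ('g \<Rightarrow> 'a \<rightharpoonup> 'a) \<Rightarrow> bool" where
  "partial_action G R D \<alpha> \<longleftrightarrow> groupoid G \<and> subrng R \<and>
     (\<forall>g \<in> Mor G. ideal_in (D (tgt G g)) R \<and> ideal_in (D g) (D (tgt G g)) \<and>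
                   rng_iso (D (ginv G g)) (D g) (\<alpha> g)) \<and>
     (\<forall>y \<in> Obj G. \<alpha> y = id_map (D y)) \<and>
     (\<forall>g \<in> Mor G. \<forall>h \<in> Mor G. src G g = tgt G h \<longrightarrow> \<alpha> g \<circ>\<^sub>m \<alpha> h \<subseteq>\<^sub>m \<alpha> (gmul G g h))"

text \<open>Groups are groupoids \<open>H\<close> with a single object \<open>e\<close>.\<close>

definition partial_group_action ::
  "'g gpd \<Rightarrow> 'g \<Rightarrow> 'a::ring set \<Rightarrow> ('g \<Rightarrow> 'a set) \<Rightarrow> ('g \<Rightarrow> 'a \<rightharpoonup> 'a) \<Rightarrow> bool" where
  "partial_group_action H e R D \<alpha> \<longleftrightarrow> Obj H = {e} \<and> partial_action H R D \<alpha> \<and> D e = R"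

definition unital_partial_group_action ::
  "'g gpd \<Rightarrow> 'g \<Rightarrow> 'a::ring set \<Rightarrow> ('g \<Rightarrow> 'a set) \<Rightarrow> ('g \<Rightarrow> 'a \<rightharpoonup> 'a) \<Rightarrow> bool" where
  "unital_partial_group_action H e R D \<alpha> \<longleftrightarrow> partial_group_action H e R D \<alpha> \<and>
     (\<forall>h \<in> Mor H. unital (D h) \<and> central_idempotent (identity_of (D h)) R)"

definition transversal_global :: "'g gpd \<Rightarrow> 'g \<Rightarrow> ('g \<Rightarrow> 'g) \<Rightarrow> ('g \<Rightarrow> 'a set) \<Rightarrow> bool" where
  "transversal_global G x \<tau> D \<longleftrightarrow> (\<forall>y \<in> Obj G. D (ginv G (\<tau> y)) = D x \<and> D (\<tau> y) = D y)"


section \<open>Lifting data\<close>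

text \<open>
  The ideals \<open>I\<^sub>y\<close>, \<open>I\<close> at \<open>\<tau>\<^sub>y\<close> and at \<open>\<tau>\<^sub>y\<^sup>-\<^sup>1\<close>, and \<open>I\<^sub>h\<close> for \<open>h\<close> in the isotropy group are the values
  of one family \<open>I\<close> indexed by morphisms, and likewise for \<open>\<gamma>\<close>. For a transversal with \<open>\<tau> x = x\<close>
  these index sets share only the index \<open>x\<close>, where the entries have to coincide anyway. The values of \<open>I\<close> and \<open>\<gamma>\<close> at all other indices are irrelevant.
\<close>

definition lifting_datum ::
  "'g gpd \<Rightarrow> 'g \<Rightarrow> ('g \<Rightarrow> 'g) \<Rightarrow> 'a::ring set \<Rightarrow> ('g \<Rightarrow> 'a set) \<Rightarrow> ('g \<Rightarrow> 'a \<rightharpoonup> 'a) \<Rightarrow> bool" where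
  "lifting_datum G x \<tau> A I \<gamma> \<longleftrightarrow>
     (\<forall>y \<in> Obj G. ideal_in (I y) A) \<and>
     (\<forall>y \<in> Obj G. rng_iso (I (ginv G (\<tau> y))) (I (\<tau> y)) (\<gamma> (\<tau> y))) \<and>
     partial_group_action (isotropy G x) x (I x) I \<gamma> \<and>
     \<gamma> x = id_map (I x) \<and> \<gamma> (\<tau> x) = id_map (I x) \<and> I (\<tau> x) = I x \<and>
     (\<forall>y \<in> Obj G. ideal_in (I (\<tau> y)) (I y) \<and> ideal_in (I (ginv G (\<tau> y))) (I x)) \<and>
     (\<forall>g \<in> Mor G.
        ideal_in
          (ran (\<gamma> (\<tau> (tgt G g)) |` (I (ginv G (\<tau> (tgt G g))) \<inter>
             ran (\<gamma> (to_isotropy G \<tau> g) |`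
               (I (ginv G (\<tau> (src G g))) \<inter> I (ginv G (to_isotropy G \<tau> g)))))))
          (I (tgt G g)))"

definition lifted_action ::
  "'g gpd \<Rightarrow> ('g \<Rightarrow> 'g) \<Rightarrow> ('g \<Rightarrow> 'a set) \<Rightarrow> ('g \<Rightarrow> 'a \<rightharpoonup> 'a) \<Rightarrow> 'g \<Rightarrow> 'a \<rightharpoonup> 'a" where
  "lifted_action G \<tau> I \<gamma> g =
     (if g \<in> Obj G then id_map (I g)
      else \<gamma> (\<tau> (tgt G g)) \<circ>\<^sub>m \<gamma> (to_isotropy G \<tau> g) \<circ>\<^sub>m inv_map (\<gamma> (\<tau> (src G g))))"

definition lifted_ideal ::
  "'g gpd \<Rightarrow> ('g \<Rightarrow> 'g) \<Rightarrow> ('g \<Rightarrow> 'a set) \<Rightarrow> ('g \<Rightarrow> 'a \<rightharpoonup> 'a) \<Rightarrow> 'g \<Rightarrow> 'a set" where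
  "lifted_ideal G \<tau> I \<gamma> g = ran (lifted_action G \<tau> I \<gamma> g)"

definition gamma_unital ::
  "'g gpd \<Rightarrow> 'g \<Rightarrow> ('g \<Rightarrow> 'a::ring set) \<Rightarrow> ('g \<Rightarrow> 'a \<rightharpoonup> 'a) \<Rightarrow> bool" where
  "gamma_unital G x I \<gamma> \<longleftrightarrow>
     unital (I x) \<and> unital_partial_group_action (isotropy G x) x (I x) I \<gamma>"


section \<open>Invariants and traces\<close>

text \<open>Both are used only when every \<open>D g\<close> has an identity \<open>1\<^sub>g\<close>, here \<open>identity_of (D g)\<close>.\<close>

definition invariants ::
  "'g gpd \<Rightarrow> 'a::ring set \<Rightarrow> ('g \<Rightarrow> 'a set) \<Rightarrow> ('g \<Rightarrow> 'a \<rightharpoonup> 'a) \<Rightarrow> 'a set" where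
  "invariants G R D \<alpha> =
     {a \<in> R. \<forall>g \<in> Mor G. \<alpha> g (a * identity_of (D (ginv G g))) = Some (a * identity_of (D g))}"

definition trace_map ::
  "'g gpd \<Rightarrow> ('g \<Rightarrow> 'a::ring set) \<Rightarrow> ('g \<Rightarrow> 'a \<rightharpoonup> 'a) \<Rightarrow> 'a \<Rightarrow> 'a" where
  "trace_map G D \<alpha> a = (\<Sum>g \<in> Mor G. the (\<alpha> g (a * identity_of (D (ginv G g)))))"

end

theory Submission imports Defs begin

text \<open>
  Globality makes each \<open>\<gamma>\<close> at \<open>\<tau>\<^sub>y\<close> a ring isomorphism \<open>\<phi>\<^sub>y : I\<^sub>x \<rightarrow> I\<^sub>y\<close>, so that an element \<open>a\<close> of
  \<open>A\<close> amounts to a family \<open>b\<^sub>y = \<phi>\<^sub>y\<^sup>-\<^sup>1(a 1\<^sub>y)\<close> in \<open>I\<^sub>x\<close>. A morphism \<open>g : y \<rightarrow> z\<close> is the same as a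
  triple \<open>(y, z, h)\<close> with \<open>h = g\<^sub>x\<close>, and \<open>\<beta>\<^sub>g\<close> sends \<open>\<phi>\<^sub>y(b\<^sub>y e)\<close> to \<open>\<phi>\<^sub>z(\<gamma>\<^sub>h(b\<^sub>y e))\<close>, where \<open>e\<close> is the
  identity of the domain of \<open>\<gamma>\<^sub>h\<close>. Put \<open>\<Phi>(b) = \<Sum>\<^sub>z \<phi>\<^sub>z(b)\<close>, an injective map on \<open>I\<^sub>x\<close>. Taking
  \<open>h = x\<close> shows that an invariant has constant family, so the invariants of \<open>\<beta>\<close> are the \<open>\<Phi>\<close>-image
  of those of the restriction; and the trace of \<open>a\<close> is \<open>\<Phi>\<close> of the trace of \<open>\<Sum>\<^sub>y b\<^sub>y\<close>, so the same
  holds for the images of the traces.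
\<close>

section \<open>Groupoids with a transversal\<close>

context groupoid
begin

lemma ObjD:
  assumes "y \<in> Obj G"
  shows "y \<in> Mor G" "src G y = y" "tgt G y = y"
  using assms by (auto simp: Obj_def src_closed src_src tgt_src)

lemma src_in_Obj: "g \<in> Mor G \<Longrightarrow> src G g \<in> Obj G"
  by (simp add: Obj_def)

lemma tgt_in_Obj: "g \<in> Mor G \<Longrightarrow> tgt G g \<in> Obj G"
  unfolding Obj_def using src_tgt tgt_closed by (metis image_eqI)

text \<open>The trailing factor \<open>k\<close> is there because \<open>mul_assoc\<close> nests
  products to the right, so an adjacent inverse pair normally heads a longer product.\<close>

lemma mul_inv_cancel:
  assumes "a \<in> Mor G" "k \<in> Mor G" "tgt G a = tgt G k"
  shows "gmul G a (gmul G (ginv G a) k) = k"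
  using assms by (metis mul_assoc inv_closed src_inv tgt_inv mul_inv tgt_mul_self)

lemma inv_mul_cancel:
  assumes "a \<in> Mor G" "k \<in> Mor G" "src G a = tgt G k"
  shows "gmul G (ginv G a) (gmul G a k) = k"
  using assms by (metis mul_assoc inv_closed src_inv inv_mul tgt_mul_self)

lemma inv_unique:
  assumes "g \<in> Mor G" "h \<in> Mor G" "src G g = tgt G h" "gmul G g h = tgt G g"
  shows "h = ginv G g"
  using assms by (metis inv_mul_cancel inv_closed src_inv mul_src)

lemma inv_Obj: "y \<in> Obj G \<Longrightarrow> ginv G y = y"
  using inv_unique[of y y] ObjD[of y] mul_src[of y] by simp

end

locale groupoid_transversal = groupoid G for G :: "'g gpd" +
  fixes x :: 'g and \<tau> :: "'g \<Rightarrow> 'g"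
  assumes x_Obj: "x \<in> Obj G" and trans: "transversal G x \<tau>"
begin

abbreviation iso :: "'g \<Rightarrow> 'g" where "iso \<equiv> to_isotropy G \<tau>"

abbreviation X :: "'g set" where "X \<equiv> Hom G x x"

lemma tau:
  assumes "y \<in> Obj G"
  shows "\<tau> y \<in> Mor G" "src G (\<tau> y) = x" "tgt G (\<tau> y) = y"
  using assms trans by (auto simp: transversal_def Hom_def)

lemma tau_x: "\<tau> x = x"
  using trans by (simp add: transversal_def)

lemma inv_x: "ginv G x = x"
  using inv_Obj x_Obj by simp

lemma x_in_X: "x \<in> X"
  using ObjD[OF x_Obj] by (simp add: Hom_def)

lemma XD:
  assumes "h \<in> X"
  shows "h \<in> Mor G" "src G h = x" "tgt G h = x"
  using assms by (auto simp: Hom_def)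

lemma inv_in_X: "h \<in> X \<Longrightarrow> ginv G h \<in> X"
  by (auto simp: Hom_def inv_closed src_inv tgt_inv)

lemmas gpd_simps = src_in_Obj tgt_in_Obj tau inv_closed src_inv tgt_inv mul_closed src_mul
  tgt_mul mul_assoc mul_inv_cancel inv_mul_cancel

lemma iso_in_X: "g \<in> Mor G \<Longrightarrow> iso g \<in> X"
  by (simp add: to_isotropy_def Hom_def gpd_simps)

text \<open>By uniqueness of inverses: in the product of the two sides everything cancels from the
  middle outwards. This ties the domain of \<open>\<gamma> (iso g)\<close> to the ideal
  \<open>B (ginv G g)\<close>.\<close>

lemma iso_inv:
  assumes "g \<in> Mor G"
  shows "iso (ginv G g) = ginv G (iso g)"
proof (rule inv_unique)
  show "iso g \<in> Mor G" "iso (ginv G g) \<in> Mor G" "src G (iso g) = tgt G (iso (ginv G g))"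
    using iso_in_X assms inv_closed by (auto simp: Hom_def)
  show "gmul G (iso g) (iso (ginv G g)) = tgt G (iso g)"
    using assms by (simp add: to_isotropy_def gpd_simps inv_mul)
qed

lemma iso_Obj: "y \<in> Obj G \<Longrightarrow> iso y = x"
  using tau tgt_mul_self[of "\<tau> y"] inv_mul[of "\<tau> y"] ObjD[of y]
  by (simp add: to_isotropy_def)

lemma iso_tau:
  assumes "y \<in> Obj G"
  shows "iso (\<tau> y) = x" and "iso (ginv G (\<tau> y)) = x"
proof -
  have "gmul G (\<tau> y) x = \<tau> y"
    using mul_src[of "\<tau> y"] tau[OF assms] by simp
  then show "iso (\<tau> y) = x"
    using inv_mul[of "\<tau> y"] tau[OF assms] by (simp add: to_isotropy_def tau_x)
  then show "iso (ginv G (\<tau> y)) = x"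
    by (simp add: iso_inv tau[OF assms] inv_x)
qed

lemma iso_of_X: "h \<in> X \<Longrightarrow> iso h = h"
  using XD[of h] mul_src[of h] tgt_mul_self[of h] by (simp add: to_isotropy_def tau_x inv_x)

text \<open>The inverse sends \<open>(y, z, h)\<close> to the composite of \<open>\<tau> z\<close>,
  \<open>h\<close> and the inverse of \<open>\<tau> y\<close>. It serves to reindex the trace and to
  realise any prescribed triple by a morphism.\<close>

lemma bij_betw_iso:
  "bij_betw (\<lambda>g. (src G g, tgt G g, iso g)) (Mor G) (Obj G \<times> Obj G \<times> X)"
proof (rule bij_betw_byWitness)
  let ?k = "\<lambda>(y, z, h). gmul G (\<tau> z) (gmul G h (ginv G (\<tau> y)))"
  \<comment> \<open>Here the inverse pair stands at the right end of the product, out of reach of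
    the cancellation rules in \<open>gpd_simps\<close>.\<close>
  have right_inv: "gmul G g (gmul G (\<tau> y) (ginv G (\<tau> y))) = g"
    if "g \<in> Mor G" "src G g = y" "y \<in> Obj G" for g y
    using that mul_inv[of "\<tau> y"] tau[of y] mul_src[of g] by simp
  show "\<forall>g\<in>Mor G. ?k (src G g, tgt G g, iso g) = g"
    by (simp add: to_isotropy_def gpd_simps right_inv)
  have left_inv: "gmul G h (gmul G (ginv G (\<tau> y)) (\<tau> y)) = h"
    if "h \<in> X" "y \<in> Obj G" for h y
    using that inv_mul[of "\<tau> y"] tau[of y] mul_src[of h] XD[of h] by simp
  show "\<forall>p\<in>Obj G \<times> Obj G \<times> X. (src G (?k p), tgt G (?k p), iso (?k p)) = p"
    by (auto simp: to_isotropy_def gpd_simps XD left_inv)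
  show "(\<lambda>g. (src G g, tgt G g, iso g)) ` Mor G \<subseteq> Obj G \<times> Obj G \<times> X"
    by (auto simp: src_in_Obj tgt_in_Obj iso_in_X)
  show "?k ` (Obj G \<times> Obj G \<times> X) \<subseteq> Mor G"
    by (auto simp: gpd_simps XD)
qed

end

section \<open>Rings and partial bijections\<close>

lemma identity_of_eqI: "is_identity e R \<Longrightarrow> identity_of R = e"
  unfolding identity_of_def by (rule the_equality) (auto simp: is_identity_def)

lemma is_identity_identity_of: "unital R \<Longrightarrow> is_identity (identity_of R) R"
  unfolding unital_def using identity_of_eqI by auto

lemma inv_map_eq_Some_iff:
  assumes "inj_on f (dom f)"
  shows "inv_map f b = Some a \<longleftrightarrow> f a = Some b"
proof -
  have the: "(THE c. f c = Some b) = c" if "f c = Some b" for c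
    using that assms by (intro the_equality) (auto simp: inj_on_def dom_def)
  show ?thesis
  proof (cases "b \<in> ran f")
    case True
    then obtain c where "f c = Some b" by (auto simp: ran_def)
    then show ?thesis using True the by (auto simp: inv_map_def)
  qed (auto simp: inv_map_def ran_def)
qed

lemma ran_inv_map: "inj_on f (dom f) \<Longrightarrow> ran (inv_map f) = dom f"
  by (auto simp: ran_def inv_map_eq_Some_iff)

lemma id_map_eq_Some_iff: "id_map R a = Some b \<longleftrightarrow> a = b \<and> a \<in> R"
  by (auto simp: id_map_def restrict_map_def)

lemma ran_id_map [simp]: "ran (id_map R) = R"
  by (auto simp: ran_def id_map_eq_Some_iff)

lemma map_comp_id_map: "dom f \<subseteq> R \<Longrightarrow> f \<circ>\<^sub>m id_map R = f"
  by (auto simp: fun_eq_iff map_comp_def id_map_def restrict_map_def dom_def subset_iff)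
    (metis option.exhaust)

lemma id_map_comp: "ran f \<subseteq> R \<Longrightarrow> id_map R \<circ>\<^sub>m f = f"
  by (auto simp: fun_eq_iff map_comp_def id_map_def restrict_map_def ran_def subset_iff
      split: option.split)

lemma inv_map_id_map: "inv_map (id_map R) = id_map R"
  by (auto simp: fun_eq_iff inv_map_def id_map_eq_Some_iff)
    (auto simp: id_map_def restrict_map_def)

lemma rng_isoD:
  assumes "rng_iso R S f"
  shows "dom f = R" "ran f = S" "inj_on f (dom f)"
  using assms by (auto simp: rng_iso_def)

lemma rng_iso_Some:
  assumes "rng_iso R S f" "a \<in> R"
  shows "f a = Some (the (f a))" "the (f a) \<in> S"
proof -
  obtain b where "f a = Some b" using assms by (auto simp: rng_iso_def)
  then show "f a = Some (the (f a))" "the (f a) \<in> S"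
    using assms by (auto simp: rng_iso_def ran_def)
qed

lemma rng_iso_hom:
  assumes "rng_iso R S f" "a \<in> R" "b \<in> R"
  shows "the (f (a + b)) = the (f a) + the (f b)" "the (f (a * b)) = the (f a) * the (f b)"
  using assms by (auto simp: rng_iso_def)

lemma rng_iso_zero: "rng_iso R S f \<Longrightarrow> the (f 0) = 0"
  using rng_iso_hom(1)[of R S f 0 0] by (auto simp: rng_iso_def subrng_def)

lemma rng_iso_image: "rng_iso R S f \<Longrightarrow> (\<lambda>a. the (f a)) ` R = S"
  by (force simp: rng_iso_def ran_def image_iff dom_def)

lemma subrng_sum:
  "subrng R \<Longrightarrow> (\<And>i. i \<in> S \<Longrightarrow> f i \<in> R) \<Longrightarrow> sum f S \<in> R"
  by (induction S rule: infinite_finite_induct) (auto simp: subrng_def)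

lemma rng_iso_sum:
  assumes "rng_iso R S f" "\<And>i. i \<in> T \<Longrightarrow> u i \<in> R"
  shows "the (f (sum u T)) = (\<Sum>i\<in>T. the (f (u i)))"
  using assms(2)
proof (induction T rule: infinite_finite_induct)
  case (insert i T)
  have "sum u T \<in> R"
    using insert assms(1) by (intro subrng_sum) (auto simp: rng_iso_def)
  then show ?case using insert rng_iso_hom(1)[OF assms(1)] by simp
qed (auto simp: rng_iso_zero[OF assms(1)])

text \<open>The product lies in both ideals, so it is represented by the family concentrated at
  \<open>y\<close> and by the one concentrated at \<open>z\<close>. Uniqueness of the representation
  makes these equal, and comparing entries at \<open>y\<close> gives zero.\<close>

lemma internal_direct_sum_orthogonal:
  assumes "internal_direct_sum R Y J" "y \<in> Y" "z \<in> Y" "y \<noteq> z" "a \<in> J y" "b \<in> J z"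
  shows "a * b = 0"
proof -
  have fin: "finite Y" and ideal: "\<And>w. w \<in> Y \<Longrightarrow> ideal_in (J w) R"
    using assms(1) by (auto simp: internal_direct_sum_def)
  have "a \<in> R" "b \<in> R"
    using ideal[OF assms(2)] ideal[OF assms(3)] assms(5,6) by (auto simp: ideal_in_def)
  then have c: "a * b \<in> J y" "a * b \<in> J z" "a * b \<in> R"
    using ideal[OF assms(2)] ideal[OF assms(3)] assms(5,6) by (auto simp: ideal_in_def)
  define f where "f w = (\<lambda>v\<in>Y. if v = w then a * b else 0)" for w
  have "f w \<in> (\<Pi>\<^sub>E v\<in>Y. J v)" if "a * b \<in> J w" for w
    using that ideal by (auto simp: f_def ideal_in_def)
  moreover have "(\<Sum>v\<in>Y. f w v) = a * b" if "w \<in> Y" for w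
    using that fin by (simp add: f_def)
  ultimately have "f y = f z"
    using assms(1,2,3) c unfolding internal_direct_sum_def by metis
  then have "f y y = f z y" by simp
  then show ?thesis using assms(2,4) by (simp add: f_def)
qed

section \<open>Global lifted actions\<close>

locale global_lift = groupoid_transversal G x \<tau> for G :: "'g gpd" and x \<tau> +
  fixes I :: "'g \<Rightarrow> 'a::ring set" and \<gamma> :: "'g \<Rightarrow> 'a \<rightharpoonup> 'a"
  assumes finite_Mor: "finite (Mor G)"
    and datum: "lifting_datum G x \<tau> UNIV I \<gamma>"
    and global: "transversal_global G x \<tau> (lifted_ideal G \<tau> I \<gamma>)"
    and unital: "gamma_unital G x I \<gamma>"
    and direct_sum: "internal_direct_sum UNIV (Obj G) I"
begin

abbreviation B :: "'g \<Rightarrow> 'a set" where "B \<equiv> lifted_ideal G \<tau> I \<gamma>"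
abbreviation \<beta> :: "'g \<Rightarrow> 'a \<rightharpoonup> 'a" where "\<beta> \<equiv> lifted_action G \<tau> I \<gamma>"

text \<open>Total versions of the partial maps, convenient in sums and images. Only the values of
  \<open>\<phi> y\<close> on \<open>I x\<close> and of \<open>act h\<close> on
  \<open>I (ginv G h)\<close> are meaningful.\<close>

definition \<phi> :: "'g \<Rightarrow> 'a \<Rightarrow> 'a" where "\<phi> y a = the (\<gamma> (\<tau> y) a)"
definition act :: "'g \<Rightarrow> 'a \<Rightarrow> 'a" where "act h a = the (\<gamma> h a)"

abbreviation u :: "'g \<Rightarrow> 'a" where "u h \<equiv> identity_of (I h)"

section \<open>The lifted action expressed through \<open>\<phi>\<close> and the isotropy
  action\<close>

lemma Mor_isotropy: "Mor (isotropy G x) = X"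
  by (simp add: isotropy_def)

lemma ginv_isotropy: "ginv (isotropy G x) = ginv G"
  by (simp add: isotropy_def)

lemma isotropy_action:
  assumes "h \<in> X"
  shows "ideal_in (I h) (I x)" "rng_iso (I (ginv G h)) (I h) (\<gamma> h)" "is_identity (u h) (I h)"
  using assms datum unital XD[OF assms] is_identity_identity_of
  by (auto simp: lifting_datum_def gamma_unital_def partial_group_action_def
      unital_partial_group_action_def partial_action_def isotropy_def)

lemma I_sub: "h \<in> X \<Longrightarrow> I h \<subseteq> I x"
  using isotropy_action(1) by (auto simp: ideal_in_def)

lemma gamma_x: "\<gamma> x = id_map (I x)"
  using datum by (simp add: lifting_datum_def)

lemma rng_iso_tau':
  assumes "y \<in> Obj G"
  shows "rng_iso (I (ginv G (\<tau> y))) (I (\<tau> y)) (\<gamma> (\<tau> y))" "I (ginv G (\<tau> y)) \<subseteq> I x"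
  using assms datum by (auto simp: lifting_datum_def ideal_in_def)

lemma B_Obj: "y \<in> Obj G \<Longrightarrow> B y = I y"
  by (simp add: lifted_ideal_def lifted_action_def)

text \<open>Globality speaks of \<open>B\<close>. As \<open>iso\<close> sends
  \<open>\<tau> y\<close> and its inverse to \<open>x\<close>, all but one factor of the composite
  is an identity, so \<open>\<beta>\<close> at these morphisms is \<open>\<gamma> (\<tau> y)\<close>
  or its inverse and the condition passes to \<open>I\<close>.\<close>

lemma global_ideals:
  assumes y: "y \<in> Obj G"
  shows "I (\<tau> y) = I y" and "I (ginv G (\<tau> y)) = I x"
proof -
  note t = tau[OF y] and r = rng_iso_tau'[OF y]
  have "I (\<tau> y) = I y \<and> I (ginv G (\<tau> y)) = I x"
  proof (cases "y = x")
    case True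
    then show ?thesis by (simp add: tau_x inv_x)
  next
    case False
    \<comment> \<open>An object has equal source and target, which would force
      \<open>y = x\<close>.\<close>
    have "\<tau> y \<notin> Obj G" "ginv G (\<tau> y) \<notin> Obj G"
      using False ObjD[of "\<tau> y"] ObjD[of "ginv G (\<tau> y)"] t by (auto simp: src_inv tgt_inv)
    then have "\<beta> (\<tau> y) = \<gamma> (\<tau> y)" "\<beta> (ginv G (\<tau> y)) = inv_map (\<gamma> (\<tau> y))"
      using t r rng_isoD[OF r(1)]
      by (simp_all add: lifted_action_def iso_tau y tau_x gamma_x map_comp_id_map
          inv_map_id_map id_map_comp ran_inv_map src_inv tgt_inv)
    then have "B (\<tau> y) = I (\<tau> y)" "B (ginv G (\<tau> y)) = I (ginv G (\<tau> y))"
      using rng_isoD[OF r(1)] by (simp_all add: lifted_ideal_def ran_inv_map)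
    then show ?thesis
      using global y x_Obj by (auto simp: transversal_global_def B_Obj)
  qed
  then show "I (\<tau> y) = I y" and "I (ginv G (\<tau> y)) = I x" by auto
qed

lemma rng_iso_tau: "y \<in> Obj G \<Longrightarrow> rng_iso (I x) (I y) (\<gamma> (\<tau> y))"
  using rng_iso_tau'(1) global_ideals by metis

lemma phi:
  assumes "y \<in> Obj G"
  shows phi_in: "a \<in> I x \<Longrightarrow> \<phi> y a \<in> I y"
    and gamma_tau: "a \<in> I x \<Longrightarrow> \<gamma> (\<tau> y) a = Some (\<phi> y a)"
    and phi_mult: "a \<in> I x \<Longrightarrow> b \<in> I x \<Longrightarrow> \<phi> y (a * b) = \<phi> y a * \<phi> y b"
    and phi_image: "\<phi> y ` I x = I y"
    and phi_inj: "a \<in> I x \<Longrightarrow> b \<in> I x \<Longrightarrow> \<phi> y a = \<phi> y b \<Longrightarrow> a = b"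
proof -
  note r = rng_iso_tau[OF assms]
  show "a \<in> I x \<Longrightarrow> \<phi> y a \<in> I y" "a \<in> I x \<Longrightarrow> \<gamma> (\<tau> y) a = Some (\<phi> y a)"
    "a \<in> I x \<Longrightarrow> b \<in> I x \<Longrightarrow> \<phi> y (a * b) = \<phi> y a * \<phi> y b" "\<phi> y ` I x = I y"
    using rng_iso_Some[OF r] rng_iso_hom[OF r] rng_iso_image[OF r] by (auto simp: \<phi>_def)
  show "a \<in> I x \<Longrightarrow> b \<in> I x \<Longrightarrow> \<phi> y a = \<phi> y b \<Longrightarrow> a = b"
    using rng_iso_Some(1)[OF r] r unfolding \<phi>_def rng_iso_def inj_on_def by metis
qed

lemma phi_sum:
  assumes "y \<in> Obj G" "\<And>i. i \<in> T \<Longrightarrow> f i \<in> I x"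
  shows "\<phi> y (sum f T) = (\<Sum>i\<in>T. \<phi> y (f i))"
  using rng_iso_sum[OF rng_iso_tau[OF assms(1)] assms(2)] by (simp add: \<phi>_def)

lemma phi_x: "a \<in> I x \<Longrightarrow> \<phi> x a = a"
  by (simp add: \<phi>_def tau_x gamma_x id_map_def)

lemma act_in:
  assumes "h \<in> X" "a \<in> I (ginv G h)"
  shows "act h a \<in> I h" "\<gamma> h a = Some (act h a)"
  using rng_iso_Some[OF isotropy_action(2)] assms by (auto simp: act_def)

lemma act_sum:
  assumes "h \<in> X" "\<And>i. i \<in> T \<Longrightarrow> f i \<in> I (ginv G h)"
  shows "act h (sum f T) = (\<Sum>i\<in>T. act h (f i))"
  using rng_iso_sum[OF isotropy_action(2)[OF assms(1)] assms(2)] by (simp add: act_def)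

lemma act_x: "a \<in> I x \<Longrightarrow> act x a = a"
  by (simp add: act_def gamma_x id_map_def)

lemma u_in: "h \<in> X \<Longrightarrow> u h \<in> I h"
  using isotropy_action(3) by (simp add: is_identity_def)

lemma mult_u_in: "h \<in> X \<Longrightarrow> b \<in> I x \<Longrightarrow> b * u h \<in> I h"
  using isotropy_action(1) u_in by (auto simp: ideal_in_def)

lemma mult_u_x: "b \<in> I x \<Longrightarrow> b * u x = b" "b \<in> I x \<Longrightarrow> u x * b = b"
  using isotropy_action(3)[OF x_in_X] by (auto simp: is_identity_def)

lemma subrng_I_x: "subrng (I x)"
  using isotropy_action(1)[OF x_in_X] by (auto simp: ideal_in_def)

text \<open>The separate clause for objects agrees with the composite: there
  \<open>iso g = x\<close>, and \<open>\<gamma> (\<tau> g)\<close> after its inverse is the identity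
  on its range, which is \<open>I g\<close> by globality.\<close>

lemma lifted_action_eq:
  assumes "g \<in> Mor G"
  shows "\<beta> g = \<gamma> (\<tau> (tgt G g)) \<circ>\<^sub>m \<gamma> (iso g) \<circ>\<^sub>m inv_map (\<gamma> (\<tau> (src G g)))"
proof (cases "g \<in> Obj G")
  case True
  note r = rng_iso_tau[OF True]
  have "\<gamma> (\<tau> g) \<circ>\<^sub>m inv_map (\<gamma> (\<tau> g)) = id_map (I g)"
  proof
    fix a
    show "(\<gamma> (\<tau> g) \<circ>\<^sub>m inv_map (\<gamma> (\<tau> g))) a = id_map (I g) a"
    proof (cases "a \<in> I g")
      case True
      then obtain c where "\<gamma> (\<tau> g) c = Some a"
        using rng_isoD(2)[OF r] by (auto simp: ran_def)
      then show ?thesis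
        using True inv_map_eq_Some_iff[OF rng_isoD(3)[OF r]] by (simp add: id_map_def)
    next
      case False
      then show ?thesis
        using rng_isoD(2)[OF r] by (simp add: id_map_def inv_map_def map_comp_def)
    qed
  qed
  then show ?thesis
    using True rng_isoD[OF r]
    by (simp add: lifted_action_def ObjD iso_Obj gamma_x map_comp_id_map)
qed (simp add: lifted_action_def)

lemma lifted_action_apply:
  assumes "g \<in> Mor G" "c \<in> I (ginv G (iso g))"
  shows "\<beta> g (\<phi> (src G g) c) = Some (\<phi> (tgt G g) (act (iso g) c))"
proof -
  note h = iso_in_X[OF assms(1)]
  have c: "c \<in> I x" using I_sub[OF inv_in_X[OF h]] assms(2) by auto
  have "inv_map (\<gamma> (\<tau> (src G g))) (\<phi> (src G g) c) = Some c"
    using inv_map_eq_Some_iff[OF rng_isoD(3)[OF rng_iso_tau]] gamma_tau c src_in_Obj assms(1)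
    by simp
  moreover have "act (iso g) c \<in> I x" using act_in(1)[OF h assms(2)] I_sub[OF h] by auto
  ultimately show ?thesis
    using act_in(2)[OF h assms(2)] gamma_tau[OF tgt_in_Obj[OF assms(1)]]
    by (simp add: lifted_action_eq[OF assms(1)])
qed

lemma lifted_ideal_eq:
  assumes g: "g \<in> Mor G"
  shows "B g = \<phi> (tgt G g) ` I (iso g)"
proof
  note h = iso_in_X[OF g]
  note r = isotropy_action(2)[OF h]
  show "B g \<subseteq> \<phi> (tgt G g) ` I (iso g)"
    using rng_isoD(2)[OF r]
    by (force simp: lifted_ideal_def lifted_action_eq[OF g] ran_def map_comp_Some_iff \<phi>_def)
  show "\<phi> (tgt G g) ` I (iso g) \<subseteq> B g"
  proof
    fix b assume "b \<in> \<phi> (tgt G g) ` I (iso g)"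
    then obtain c where "c \<in> I (ginv G (iso g))" "b = \<phi> (tgt G g) (act (iso g) c)"
      using rng_iso_image[OF r] unfolding act_def by (metis (no_types, lifting) imageE)
    then show "b \<in> B g"
      using lifted_action_apply[OF g] by (auto simp: lifted_ideal_def ran_def)
  qed
qed

lemma identity_of_lifted:
  assumes "g \<in> Mor G"
  shows "identity_of (B g) = \<phi> (tgt G g) (u (iso g))"
proof (rule identity_of_eqI)
  note h = iso_in_X[OF assms] and t = tgt_in_Obj[OF assms]
  have *: "\<phi> (tgt G g) (u (iso g)) * \<phi> (tgt G g) c = \<phi> (tgt G g) c"
    "\<phi> (tgt G g) c * \<phi> (tgt G g) (u (iso g)) = \<phi> (tgt G g) c" if "c \<in> I (iso g)" for c
    using that I_sub[OF h] u_in[OF h] isotropy_action(3)[OF h]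
    by (auto simp: phi_mult[OF t, symmetric] subset_iff is_identity_def)
  then show "is_identity (\<phi> (tgt G g) (u (iso g))) (B g)"
    using u_in[OF h] by (auto simp: is_identity_def lifted_ideal_eq[OF assms])
qed

text \<open>The element \<open>b\<^sub>y\<close> of \<open>I\<^sub>x\<close> that corresponds to the component of \<open>a\<close> in \<open>I\<^sub>y\<close>.\<close>

definition coord :: "'g \<Rightarrow> 'a \<Rightarrow> 'a" where
  "coord y a = (SOME b. b \<in> I x \<and> \<phi> y b = a * \<phi> y (u x))"

lemma coord:
  assumes "y \<in> Obj G"
  shows coord_in: "coord y a \<in> I x" and phi_coord: "\<phi> y (coord y a) = a * \<phi> y (u x)"
proof -
  have "a * \<phi> y (u x) \<in> I y"
    using datum assms phi_in[OF assms u_in[OF x_in_X]] by (auto simp: lifting_datum_def ideal_in_def)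
  then have "\<exists>b. b \<in> I x \<and> \<phi> y b = a * \<phi> y (u x)"
    using phi_image[OF assms] by (metis imageE)
  from someI_ex[OF this] show "coord y a \<in> I x" "\<phi> y (coord y a) = a * \<phi> y (u x)"
    by (auto simp: coord_def)
qed

text \<open>The identity \<open>u h\<close> absorbs \<open>u x\<close>, so \<open>a\<close> may
  first be multiplied into \<open>I y\<close> and then pulled back along
  \<open>\<phi> y\<close>.\<close>

lemma mult_identity:
  assumes "y \<in> Obj G" "h \<in> X"
  shows "a * \<phi> y (u h) = \<phi> y (coord y a * u h)"
proof -
  have "u h \<in> I x" using u_in I_sub assms by auto
  then have "a * \<phi> y (u h) = a * \<phi> y (u x) * \<phi> y (u h)"
    using phi_mult[OF assms(1) u_in[OF x_in_X], of "u h"] mult_u_x by (simp add: mult.assoc)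
  also have "\<dots> = \<phi> y (coord y a * u h)"
    using assms \<open>u h \<in> I x\<close> by (simp add: phi_coord phi_mult coord_in)
  finally show ?thesis .
qed

lemma lifted_action_mult_identity:
  assumes g: "g \<in> Mor G"
  shows "\<beta> g (a * identity_of (B (ginv G g))) =
    Some (\<phi> (tgt G g) (act (iso g) (coord (src G g) a * u (ginv G (iso g)))))"
proof -
  note h = inv_in_X[OF iso_in_X[OF g]]
  have "a * identity_of (B (ginv G g)) = \<phi> (src G g) (coord (src G g) a * u (ginv G (iso g)))"
    using g h by (simp add: identity_of_lifted inv_closed tgt_inv iso_inv mult_identity src_in_Obj)
  then show ?thesis
    using lifted_action_apply[OF g mult_u_in[OF h coord_in]] g src_in_Obj by simp
qed

section \<open>The direct sum decomposition and the diagonal map \<open>\<Phi>\<close>\<close>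

lemma finite_Obj: "finite (Obj G)"
  using finite_Mor by (simp add: Obj_def)

definition \<Phi> :: "'a \<Rightarrow> 'a" where "\<Phi> b = (\<Sum>y\<in>Obj G. \<phi> y b)"

lemma orthogonal:
  assumes "y \<in> Obj G" "z \<in> Obj G" "y \<noteq> z" "a \<in> I y" "b \<in> I z"
  shows "a * b = 0"
  by (rule internal_direct_sum_orthogonal[OF direct_sum assms])

text \<open>\<open>\<phi> y (u x)\<close> is the identity of \<open>I y\<close> and annihilates the
  other summands, so multiplying by it projects onto the component at \<open>y\<close>.\<close>

lemma sum_mult_unit:
  assumes y: "y \<in> Obj G" and f: "\<And>z. z \<in> Obj G \<Longrightarrow> f z \<in> I z"
  shows "(\<Sum>z\<in>Obj G. f z) * \<phi> y (u x) = f y"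
proof -
  obtain c where c: "c \<in> I x" "f y = \<phi> y c" using f[OF y] phi_image[OF y] by (metis imageE)
  have "f z * \<phi> y (u x) = (if z = y then f y else 0)" if "z \<in> Obj G" for z
    using orthogonal[OF that y _ f[OF that] phi_in[OF y u_in[OF x_in_X]]] c
      phi_mult[OF y c(1) u_in[OF x_in_X]] mult_u_x by auto
  then show ?thesis
    using y finite_Obj by (simp add: sum_distrib_right)
qed

lemma coord_Phi:
  assumes "y \<in> Obj G" "b \<in> I x"
  shows "coord y (\<Phi> b) = b"
  using phi_inj[OF assms(1) coord_in assms(2)] sum_mult_unit[of y "\<lambda>z. \<phi> z b"] assms
  by (simp add: phi_coord phi_in \<Phi>_def)

lemma inj_Phi: "inj_on \<Phi> (I x)"
  by (rule inj_on_inverseI[where g = "coord x"]) (rule coord_Phi[OF x_Obj])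

lemma sum_phi_coord: "(\<Sum>y\<in>Obj G. \<phi> y (coord y a)) = a"
proof -
  obtain f where f: "f \<in> (\<Pi>\<^sub>E y\<in>Obj G. I y)" "a = (\<Sum>y\<in>Obj G. f y)"
    using direct_sum unfolding internal_direct_sum_def by blast
  then have "f y = \<phi> y (coord y a)" if "y \<in> Obj G" for y
    using that sum_mult_unit[OF that, of f] by (auto simp: phi_coord PiE_iff)
  then have "(\<Sum>y\<in>Obj G. \<phi> y (coord y a)) = (\<Sum>y\<in>Obj G. f y)"
    by (intro sum.cong refl) metis
  then show ?thesis using f(2) by metis
qed

section \<open>Trace and invariants of the lifted action\<close>

definition tr :: "'a \<Rightarrow> 'a" where "tr b = (\<Sum>h\<in>X. act h (b * u (ginv G h)))"

text \<open>Like \<open>tr\<close>, this is phrased with the isotropy action \<open>\<gamma>\<close>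
  itself; \<open>trace_isotropy\<close> and \<open>invariants_isotropy\<close> make the link to the
  restriction of \<open>\<beta>\<close>.\<close>

definition fixed_x :: "'a set" where
  "fixed_x = {b \<in> I x. \<forall>h\<in>X. act h (b * u (ginv G h)) = b * u h}"

lemma act_mult_in: "h \<in> X \<Longrightarrow> b \<in> I x \<Longrightarrow> act h (b * u (ginv G h)) \<in> I x"
  using act_in(1) mult_u_in inv_in_X I_sub by blast

lemma tr_in: "b \<in> I x \<Longrightarrow> tr b \<in> I x"
  unfolding tr_def using subrng_I_x act_mult_in by (auto intro: subrng_sum)

text \<open>Once the sum runs over triples, the source \<open>y\<close> enters only through the
  argument \<open>coord y a\<close>, so additivity moves the sum over \<open>y\<close> inside
  \<open>act\<close> and \<open>\<phi>\<close>; the remaining sum over targets \<open>z\<close> is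
  \<open>\<Phi>\<close>.\<close>

lemma trace_map_eq: "trace_map G B \<beta> a = \<Phi> (tr (\<Sum>y\<in>Obj G. coord y a))"
proof -
  let ?F = "\<lambda>(y, z, h). \<phi> z (act h (coord y a * u (ginv G h)))"
  have "trace_map G B \<beta> a = (\<Sum>g\<in>Mor G. ?F (src G g, tgt G g, iso g))"
    by (simp add: trace_map_def lifted_action_mult_identity)
  also have "\<dots> = (\<Sum>p\<in>Obj G \<times> Obj G \<times> X. ?F p)"
    by (rule sum.reindex_bij_betw[OF bij_betw_iso])
  also have "\<dots> = (\<Sum>y\<in>Obj G. \<Sum>z\<in>Obj G. \<Sum>h\<in>X. ?F (y, z, h))"
    by (simp add: sum.cartesian_product)
  also have "\<dots> = (\<Sum>z\<in>Obj G. \<Sum>h\<in>X. \<Sum>y\<in>Obj G. ?F (y, z, h))"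
    by (subst sum.swap) (auto intro!: sum.cong simp: sum.swap[of _ X])
  also have "\<dots> = (\<Sum>z\<in>Obj G. \<Sum>h\<in>X. \<phi> z (act h ((\<Sum>y\<in>Obj G. coord y a) * u (ginv G h))))"
    by (auto intro!: sum.cong simp: sum_distrib_right act_sum phi_sum mult_u_in inv_in_X coord_in
        act_mult_in)
  also have "\<dots> = \<Phi> (tr (\<Sum>y\<in>Obj G. coord y a))"
    unfolding \<Phi>_def tr_def
    by (auto intro!: sum.cong phi_sum[symmetric] act_mult_in subrng_sum subrng_I_x coord_in)
  finally show ?thesis .
qed

lemma trace_image: "trace_map G B \<beta> ` UNIV = \<Phi> ` tr ` I x"
proof -
  have "(\<Sum>y\<in>Obj G. coord y a) \<in> I x" for a
    by (intro subrng_sum subrng_I_x coord_in)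
  \<comment> \<open>The witness is \<open>b\<close> itself: it lies in \<open>I x\<close>, so by
    orthogonality all its coordinates away from \<open>x\<close> vanish.\<close>
  moreover have "\<exists>a. (\<Sum>y\<in>Obj G. coord y a) = b" if b: "b \<in> I x" for b
  proof
    have "coord y b = (if y = x then b else 0)" if y: "y \<in> Obj G" for y
    proof -
      have "\<phi> y (coord y b) = \<phi> y (if y = x then b else 0)"
        using orthogonal[OF x_Obj y _ b phi_in[OF y u_in[OF x_in_X]]] b mult_u_x
          rng_iso_zero[OF rng_iso_tau[OF y]]
        by (auto simp: phi_coord[OF y] phi_x u_in[OF x_in_X] \<phi>_def[of y 0])
      then show ?thesis
        using phi_inj[OF y coord_in[OF y]] b subrng_I_x by (simp add: subrng_def split: if_splits)
    qed
    then show "(\<Sum>y\<in>Obj G. coord y b) = b"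
      using finite_Obj x_Obj by simp
  qed
  ultimately show ?thesis
    by (force simp: trace_map_eq image_iff)
qed

lemma invariants_eq: "invariants G UNIV B \<beta> = \<Phi> ` fixed_x"
proof -
  \<comment> \<open>Both sides of the invariance condition are values of
    \<open>\<phi> (tgt G g)\<close> on \<open>I x\<close>, where that map is injective.\<close>
  have iff: "\<beta> g (a * identity_of (B (ginv G g))) = Some (a * identity_of (B g)) \<longleftrightarrow>
      act (iso g) (coord (src G g) a * u (ginv G (iso g))) = coord (tgt G g) a * u (iso g)"
    if g: "g \<in> Mor G" for a g
  proof -
    note h = iso_in_X[OF g] and t = tgt_in_Obj[OF g] and s = src_in_Obj[OF g]
    have "coord (tgt G g) a * u (iso g) \<in> I x"
      using mult_u_in[OF h coord_in[OF t]] I_sub[OF h] by auto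
    then show ?thesis
      using phi_inj[OF t act_mult_in[OF h coord_in[OF s]]] g
      by (auto simp: lifted_action_mult_identity identity_of_lifted mult_identity[OF t h])
  qed
  have "a \<in> \<Phi> ` fixed_x" if a: "a \<in> invariants G UNIV B \<beta>" for a
  proof -
    \<comment> \<open>The condition at \<open>g\<close> involves only its triple, and every triple
      occurs, so \<open>y\<close>, \<open>z\<close> and \<open>h\<close> can be chosen
      independently.\<close>
    have *: "act h (coord y a * u (ginv G h)) = coord z a * u h"
      if "y \<in> Obj G" "z \<in> Obj G" "h \<in> X" for y z h
    proof -
      from that have "(y, z, h) \<in> (\<lambda>g. (src G g, tgt G g, iso g)) ` Mor G"
        using bij_betw_imp_surj_on[OF bij_betw_iso] by simp
      then show ?thesis using a iff by (auto simp: invariants_def)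
    qed
    have "coord y a = coord x a" if y: "y \<in> Obj G" for y
      using *[OF y x_Obj x_in_X] y x_Obj by (simp add: inv_x mult_u_x coord_in act_x)
    then have "a = \<Phi> (coord x a)"
      using sum_phi_coord[of a] by (simp add: \<Phi>_def)
    moreover have "coord x a \<in> fixed_x"
      using * x_Obj coord_in by (auto simp: fixed_x_def)
    ultimately show ?thesis by auto
  qed
  \<comment> \<open>All coordinates of \<open>\<Phi> b\<close> equal \<open>b\<close>, so the
    condition at \<open>g\<close> becomes the one defining \<open>fixed_x\<close> at
    \<open>iso g\<close>.\<close>
  moreover have "\<Phi> b \<in> invariants G UNIV B \<beta>" if "b \<in> fixed_x" for b
    using that iso_in_X
    by (auto simp: invariants_def iff fixed_x_def coord_Phi src_in_Obj tgt_in_Obj)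
  ultimately show ?thesis by blast
qed

section \<open>Restriction to the isotropy group and conclusion\<close>

lemma lifted_action_isotropy:
  assumes "h \<in> X" "b \<in> I x"
  shows "\<beta> h (b * identity_of (B (ginv G h))) = Some (act h (b * u (ginv G h)))"
    and "identity_of (B h) = u h"
proof -
  \<comment> \<open>On the isotropy group \<open>iso\<close> is the identity, and
    \<open>\<phi> x\<close> is the identity on \<open>I x\<close> because
    \<open>\<tau> x = x\<close>; the general formulas thus return the data of
    \<open>\<gamma>\<close>.\<close>
  have id: "identity_of (B k) = u k" if "k \<in> X" for k
    using that XD[OF that] u_in[OF that] I_sub[OF that]
    by (simp add: identity_of_lifted iso_of_X phi_x subset_iff)
  then show "identity_of (B h) = u h" using assms(1) by simp
  have m: "b * u (ginv G h) \<in> I (ginv G h)" using assms mult_u_in inv_in_X by simp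
  then have "b * u (ginv G h) \<in> I x" using I_sub inv_in_X assms by blast
  then show "\<beta> h (b * identity_of (B (ginv G h))) = Some (act h (b * u (ginv G h)))"
    using lifted_action_apply[of h "b * u (ginv G h)"] m assms act_mult_in[OF assms]
    by (simp add: id inv_in_X XD iso_of_X phi_x)
qed

lemma trace_isotropy: "trace_map (isotropy G x) B \<beta> ` B x = tr ` I x"
  by (simp add: trace_map_def tr_def Mor_isotropy ginv_isotropy B_Obj x_Obj
      lifted_action_isotropy cong: image_cong)

lemma invariants_isotropy: "invariants (isotropy G x) (B x) B \<beta> = fixed_x"
  by (auto simp: invariants_def fixed_x_def Mor_isotropy ginv_isotropy B_Obj x_Obj
      lifted_action_isotropy)

lemma trace_onto_invariants_iff:
  "trace_map G B \<beta> ` UNIV = invariants G UNIV B \<beta> \<longleftrightarrow>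
    trace_map (isotropy G x) B \<beta> ` B x = invariants (isotropy G x) (B x) B \<beta>"
  unfolding trace_image invariants_eq trace_isotropy invariants_isotropy
  \<comment> \<open>Both sides of the first equation are \<open>\<Phi>\<close>-images of subsets of
    \<open>I x\<close>, so \<open>\<Phi>\<close> can be cancelled.\<close>
  by (rule inj_on_image_eq_iff[OF inj_Phi]) (auto simp: tr_in fixed_x_def)

end

theorem theorem6p4:
  fixes G :: "'g gpd" and x :: 'g and \<tau> :: "'g \<Rightarrow> 'g"
    and I B :: "'g \<Rightarrow> 'a::ring set" and \<gamma> \<beta> :: "'g \<Rightarrow> 'a \<rightharpoonup> 'a"
  assumes "groupoid G" and "finite (Mor G)" and "connected_gpd G"
    and "x \<in> Obj G" and "transversal G x \<tau>"
    and "lifting_datum G x \<tau> UNIV I \<gamma>"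
    and "\<beta> = lifted_action G \<tau> I \<gamma>" and "B = lifted_ideal G \<tau> I \<gamma>"
    and "transversal_global G x \<tau> B" and "gamma_unital G x I \<gamma>"
    and "internal_direct_sum UNIV (Obj G) I" and "internal_direct_sum UNIV (Obj G) B"
  shows "trace_map G B \<beta> ` UNIV = invariants G UNIV B \<beta> \<longleftrightarrow>
         trace_map (isotropy G x) B \<beta> ` B x = invariants (isotropy G x) (B x) B \<beta>"
proof -
  interpret groupoid G by fact
  interpret global_lift G x \<tau> I \<gamma>
    using assms by unfold_locales auto
  show ?thesis
    using trace_onto_invariants_iff assms by simp
qed

end
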